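(* Let $K=\mathbb{Q}(\sqrt{D})$ where $D\in\mathbb{Z}_{\ge2}$ is squarefree, and let $n\in\mathbb{Z}_{\ge1}$. There exists $D_n>0$ such that if $D>D_n$, then $p_K(n)=p(n)$. Moreover, let $E_n=\lfloor n/2\rfloor^2$ and let $F_n=(n-1)^2$ if $n$ is even and $F_n=n^2$ if $n$ is odd. Then: - if $D\equiv2,3\pmod4$ and $D>E_n$, then $p_K(n)=p(n)$; - if $D\equiv1\pmod4$ and $D>F_n$, then $p_K(n)=p(n)$. The bounds $E_n$ and $F_n$ are optimal, in the sense that if $D\equiv2,3\pmod4$ and $D\le E_n$, then $p_K(n)>p(n)$, and if $D\equiv1\pmod4$ and $D\le F_n$, then $p_K(n)>p(n)$.
   Context: $\mathcal{O}_K$ is the ring of integers of $K$ and $\mathcal{O}_K^+$ is the set of totally positive elements of $\mathcal{O}_K$ (elements $\gamma$ with $\gamma>0$ and $\gamma'>0$, where $'$ denotes Galois conjugation). A partition of $\alpha\in\mathcal{O}_K^+$ is an expression $\alpha=\alpha_1+\dots+\alpha_k$ with $k\ge1$ and all $\alpha_i\in\mathcal{O}_K^+$, the order of the summands being irrelevant; $p_K(\alpha)$ is the number of partitions of $\alpha$. $p(n)$ denotes the classical number of integer partitions of $n$. *)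

theory Defs
  imports
    Complex_Main
    "HOL-Library.Multiset"
    "HOL-Computational_Algebra.Polynomial"
    "HOL-Computational_Algebra.Squarefree"
begin

text \<open>
  For a squarefree integer \<open>D \<ge> 2\<close> the field \<open>\<rat>(\<surd>D)\<close> is realised inside the reals.
\<close>

definition quad_field :: "int \<Rightarrow> real set" where
  "quad_field D = {a + b * sqrt (of_int D) | a b. a \<in> \<rat> \<and> b \<in> \<rat>}"

text \<open>
  Galois conjugation; the description is only meaningful on \<open>quad_field D\<close> for \<open>D\<close> not a
  perfect square, see \<open>quad_conj_eq\<close>.
\<close>

definition quad_conj :: "int \<Rightarrow> real \<Rightarrow> real" where
  "quad_conj D x =
     (THE y. \<exists>a\<in>\<rat>. \<exists>b\<in>\<rat>. x = a + b * sqrt (of_int D) \<and> y = a - b * sqrt (of_int D))"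

definition quad_integers :: "int \<Rightarrow> real set" where
  "quad_integers D = {x \<in> quad_field D. algebraic_int x}"

definition totally_positive_integers :: "int \<Rightarrow> real set" where
  "totally_positive_integers D = {x \<in> quad_integers D. x > 0 \<and> quad_conj D x > 0}"

definition field_partitions :: "int \<Rightarrow> real \<Rightarrow> real multiset set" where
  "field_partitions D \<alpha> =
     {M. M \<noteq> {#} \<and> set_mset M \<subseteq> totally_positive_integers D \<and> sum_mset M = \<alpha>}"

definition field_partition_count :: "int \<Rightarrow> real \<Rightarrow> nat" where
  "field_partition_count D \<alpha> = card (field_partitions D \<alpha>)"

definition partition_count :: "nat \<Rightarrow> nat" where
  "partition_count n = card {M :: nat multiset. (\<forall>k\<in>#M. k > 0) \<and> sum_mset M = n}"

definition bound_E :: "nat \<Rightarrow> int" where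
  "bound_E n = \<lfloor>real n / 2\<rfloor>\<^sup>2"

definition bound_F :: "nat \<Rightarrow> int" where
  "bound_F n = (if even n then (int n - 1)\<^sup>2 else (int n)\<^sup>2)"

lemma sqrt_squarefree_irrational:
  assumes "D \<ge> 2" "squarefree D"
  shows "sqrt (of_int D) \<notin> \<rat>"
proof
  assume rat: "sqrt (of_int D) \<in> \<rat>"
  have "algebraic_int (sqrt (of_int D :: real))"
    unfolding sqrt_def by (rule algebraic_int_nth_root_real) simp
  then have "sqrt (of_int D :: real) \<in> \<int>"
    using rat by (rule rational_algebraic_int_is_int)
  then obtain k where k: "sqrt (of_int D) = of_int k" by (rule Ints_cases)
  have "of_int D = (sqrt (of_int D))\<^sup>2" using assms by simp
  then have "(of_int D :: real) = of_int (k\<^sup>2)" unfolding k by simp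
  then have D: "D = k\<^sup>2" by (simp only: of_int_eq_iff)
  then have "k\<^sup>2 dvd D" by simp
  then have "k dvd 1" by (rule squarefreeD[OF assms(2)])
  then have "k = 1 \<or> k = -1" by auto
  then have "k\<^sup>2 = 1" by auto
  with D assms(1) show False by simp
qed

lemma quad_conj_eq:
  assumes "D \<ge> 2" "squarefree D" "a \<in> \<rat>" "b \<in> \<rat>"
  shows "quad_conj D (a + b * sqrt (of_int D)) = a - b * sqrt (of_int D)"
proof -
  have uniq: "a = c \<and> b = d"
    if "c \<in> \<rat>" "d \<in> \<rat>" "a + b * sqrt (of_int D) = c + d * sqrt (of_int D)" for c d
  proof -
    have eq: "(b - d) * sqrt (of_int D) = c - a" using that(3) by (simp add: left_diff_distrib)
    have "b = d"
    proof (rule ccontr)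
      assume "b \<noteq> d"
      then have "sqrt (of_int D) = (c - a) / (b - d)" using eq by (simp add: eq_divide_eq mult.commute)
      also have "\<dots> \<in> \<rat>" using assms that by (intro Rats_divide Rats_diff)
      finally show False using sqrt_squarefree_irrational[OF assms(1,2)] by simp
    qed
    then show ?thesis using that(3) by simp
  qed
  show ?thesis unfolding quad_conj_def
  proof (rule the_equality)
    show "\<exists>c\<in>\<rat>. \<exists>d\<in>\<rat>. a + b * sqrt (of_int D) = c + d * sqrt (of_int D) \<and>
            a - b * sqrt (of_int D) = c - d * sqrt (of_int D)"
      using assms by blast
  next
    fix y
    assume "\<exists>c\<in>\<rat>. \<exists>d\<in>\<rat>. a + b * sqrt (of_int D) = c + d * sqrt (of_int D) \<and>
              y = c - d * sqrt (of_int D)"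
    then show "y = a - b * sqrt (of_int D)" using uniq by blast
  qed
qed

end

theory Submission
  imports Defs
begin

text \<open>
  By Gauss's lemma the trace and norm of an integer of \<open>\<rat>(\<surd>D)\<close> are integers, so the totally
  positive integers are the \<open>(u + v\<surd>D)/2\<close> with \<open>4 dvd u\<^sup>2 - D v\<^sup>2\<close> and \<open>u > \<bar>v\<bar>\<surd>D\<close>, and partitions of
  \<open>n\<close> become multisets of pairs \<open>(u, v)\<close> whose sum is \<open>(2n, 0)\<close>. A part with \<open>v \<noteq> 0\<close> forces a second
  such part, since the second coordinates cancel; one of the two has \<open>u \<le> n\<close>, hence
  \<open>D v\<^sup>2 < u\<^sup>2 \<le> n\<^sup>2\<close>. The congruence \<open>4 dvd u\<^sup>2 - D v\<^sup>2\<close> restricts the parities of \<open>u\<close> and \<open>v\<close>, which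
  sharpens this to the stated bounds. Conversely, below the bounds \<open>n\<close> splits into two irrational
  parts with \<open>v = \<plusminus>2\<close> or \<open>v = \<plusminus>1\<close> and \<open>u\<close> as close to \<open>n\<close> as its parity allows.
\<close>

section \<open>Gauss's lemma and integrality of trace and norm\<close>

lemma map_poly_of_int_mult:
  "map_poly of_int (p * q :: int poly) = map_poly of_int p * (map_poly of_int q :: 'a :: comm_ring_1 poly)"
  by (rule poly_eqI) (simp add: coeff_map_poly coeff_mult)

lemma map_poly_of_int_add:
  "map_poly of_int (p + q :: int poly) = map_poly of_int p + (map_poly of_int q :: 'a :: comm_ring_1 poly)"
  by (rule poly_eqI) (simp add: coeff_map_poly)

lemma map_poly_of_int_smult:
  "map_poly of_int (smult c p :: int poly) = smult (of_int c) (map_poly of_int p :: 'a :: comm_ring_1 poly)"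
  by (rule poly_eqI) (simp add: coeff_map_poly)

text \<open>Pseudo-division of the monic \<open>p\<close> by \<open>Q\<close> leaves a remainder of
  degree at most 1 that vanishes at the irrational \<open>x\<close>, hence is zero. In
  \<open>smult a p = Q * s\<close> Gauss's lemma gives \<open>content s = normalize a\<close>, so
  \<open>a\<close> divides the leading coefficient of \<open>s\<close>, while \<open>a\<close> is
  also that coefficient times the one of \<open>Q\<close>.\<close>

lemma primitive_quadratic_lead_coeff_unit:
  fixes Q p :: "int poly" and x :: "'a :: field_char_0"
  assumes Q: "content Q = 1" "degree Q = 2" "poly (map_poly of_int Q) x = 0"
    and p: "lead_coeff p = 1" "poly (map_poly of_int p) x = 0"
    and x: "x \<notin> \<rat>"
  shows "lead_coeff Q dvd 1"
proof -
  define r where "r = pseudo_mod p Q"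
  have "Q \<noteq> 0" using Q(2) by auto
  from pseudo_mod[OF this, of p] obtain a s
    where as: "a \<noteq> 0" "smult a p = Q * s + r" and deg: "r = 0 \<or> degree r < 2"
    unfolding r_def Q(2) by blast
  have "of_int a * poly (map_poly of_int p) x =
      poly (map_poly of_int Q) x * poly (map_poly of_int s) x + poly (map_poly of_int r) x"
    using arg_cong[OF as(2), of "\<lambda>f. poly (map_poly of_int f) x"]
    by (simp add: map_poly_of_int_mult map_poly_of_int_add map_poly_of_int_smult)
  then have "poly (map_poly of_int r) x = 0" using Q(3) p(2) by simp
  moreover obtain r0 r1 where r: "r = [:r0, r1:]"
  proof (cases r)
    case (pCons r0 r')
    with deg have "degree r' = 0" by (cases "r' = 0") auto
    then obtain r1 where "r' = [:r1:]" by (elim degree_eq_zeroE)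
    with pCons that show thesis by blast
  qed
  ultimately have r0: "of_int r0 + x * of_int r1 = 0"
    by (cases "r1 = 0"; cases "r0 = 0") (simp_all add: map_poly_pCons)
  have "r1 = 0"
  proof (rule ccontr)
    assume "r1 \<noteq> 0"
    then have "x = - of_int r0 / of_int r1"
      using r0 by (simp add: field_simps add_eq_0_iff)
    also have "\<dots> \<in> \<rat>" by simp
    finally show False using x by simp
  qed
  with r0 r as(2) have Qs: "smult a p = Q * s" by simp
  have "content p dvd 1" using content_dvd_coeff[of p "degree p"] p(1) by simp
  then have "content p = 1" by (simp only: is_unit_content_iff)
  with arg_cong[OF Qs, of content] Q(1) have "content s = normalize a"
    by (simp add: content_mult)
  then have "a dvd lead_coeff s"
    using content_dvd_coeff[of s "degree s"] by simp
  then obtain k where "lead_coeff s = a * k" ..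
  moreover have "a = lead_coeff Q * lead_coeff s"
    using arg_cong[OF Qs, of lead_coeff] p(1) as(1) by (simp add: lead_coeff_mult)
  ultimately have "a * (lead_coeff Q * k) = a * 1" by (simp add: ac_simps)
  with as(1) have "lead_coeff Q * k = 1" by (simp only: mult_cancel_left) simp
  then show ?thesis by (rule dvdI[OF sym])
qed

text \<open>Clearing denominators gives an integer polynomial with root \<open>x\<close> and leading
  coefficient \<open>c\<close>. Its primitive part has a unit as leading coefficient, so
  \<open>c\<close> divides the content and can be cancelled again.\<close>

lemma quadratic_algebraic_int_coeffs:
  fixes x r s :: "'a :: field_char_0"
  assumes x: "algebraic_int x" "x \<notin> \<rat>" and rs: "r \<in> \<rat>" "s \<in> \<rat>" and eq: "x\<^sup>2 = r * x + s"
  shows "r \<in> \<int>" "s \<in> \<int>"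
proof -
  from rs(1) obtain r1 r2 :: int where r: "r2 > 0" "r = of_int r1 / of_int r2"
    by (rule Rats_cases')
  from rs(2) obtain s1 s2 :: int where s: "s2 > 0" "s = of_int s1 / of_int s2"
    by (rule Rats_cases')
  define c u v where "c = r2 * s2" and "u = r1 * s2" and "v = s1 * r2"
  have c: "c > 0" and ru: "r = of_int u / of_int c" and sv: "s = of_int v / of_int c"
    using r s by (simp_all add: c_def u_def v_def field_simps)
  define f Q where "f = [:- v, - u, c:]" and "Q = primitive_part f"
  have f: "f = smult (content f) Q" by (simp add: Q_def)
  have "f \<noteq> 0" "degree f = 2" using c by (auto simp: f_def)
  then have Q: "content Q = 1" "degree Q = 2"
    unfolding Q_def by (simp_all add: content_primitive_part)
  have "poly (map_poly of_int f) x = of_int c * (x\<^sup>2 - r * x - s)"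
    using c by (simp add: f_def map_poly_pCons ru sv field_simps power2_eq_square)
  also have "\<dots> = 0" using eq by simp
  finally have "of_int (content f) * poly (map_poly of_int Q) x = 0"
    by (subst (asm) f) (simp add: map_poly_of_int_smult)
  with \<open>f \<noteq> 0\<close> have Qx: "poly (map_poly of_int Q) x = 0" by simp
  obtain p :: "int poly" where "poly (map_poly of_int p) x = 0" "lead_coeff p = 1"
    using x(1) by (auto simp: algebraic_int_altdef_ipoly)
  with primitive_quadratic_lead_coeff_unit[OF Q Qx _ _ x(2)] have "lead_coeff Q dvd 1" by blast
  then have "content f * lead_coeff Q dvd content f" by (metis dvd_refl mult.right_neutral mult_dvd_mono)
  moreover have "content f * lead_coeff Q = c"
    using arg_cong[OF f, of "\<lambda>g. coeff g 2"] Q(2) by (simp add: f_def numeral_2_eq_2)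
  ultimately have "c dvd coeff f i" for i
    using content_dvd_coeff dvd_trans by metis
  from this[of 0] this[of 1] have "c dvd u" "c dvd v" by (simp_all add: f_def)
  then show "r \<in> \<int>" "s \<in> \<int>"
    using c by (auto simp: ru sv elim!: dvdE)
qed

text \<open>The square of the reduced denominator is coprime to the square of the numerator, so it
  divides \<open>D\<close>; squarefreeness then leaves only the denominator 1.\<close>

lemma rational_mult_square_int:
  fixes s :: "'a :: field_char_0" and D :: int
  assumes "squarefree D" "s \<in> \<rat>" "of_int D * s\<^sup>2 \<in> \<int>"
  shows "s \<in> \<int>"
proof -
  from assms(2) obtain p q where pq: "q > 0" "coprime p q" "s = of_int p / of_int q"
    by (rule Rats_cases')
  from assms(3) obtain k where "of_int D * s\<^sup>2 = of_int k" by (rule Ints_cases)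
  then have "(of_int (D * p\<^sup>2) :: 'a) = of_int (k * q\<^sup>2)"
    using pq by (simp add: field_simps)
  then have "D * p\<^sup>2 = k * q\<^sup>2" by (simp only: of_int_eq_iff)
  then have "q\<^sup>2 dvd D * p\<^sup>2" by simp
  moreover have "coprime (q\<^sup>2) (p\<^sup>2)" using pq(2) by (simp add: coprime_commute)
  ultimately have "q\<^sup>2 dvd D" by (simp add: coprime_dvd_mult_left_iff)
  then have "q dvd 1" by (rule squarefreeD[OF assms(1)])
  with pq show ?thesis by simp
qed

section \<open>Integers and totally positive integers in half-integral coordinates\<close>

definition half_sqrt_comb :: "int \<Rightarrow> int \<times> int \<Rightarrow> real" where
  "half_sqrt_comb D = (\<lambda>(u, v). (of_int u + of_int v * sqrt (of_int D)) / 2)"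

text \<open>Adding the equation to its conjugate eliminates the square root.\<close>

lemma quad_field_coords_unique:
  assumes "D \<ge> 2" "squarefree D" "a \<in> \<rat>" "b \<in> \<rat>" "c \<in> \<rat>" "d \<in> \<rat>"
    and "a + b * sqrt (of_int D) = c + d * sqrt (of_int D)"
  shows "a = c" "b = d"
proof -
  have "a - b * sqrt (of_int D) = c - d * sqrt (of_int D)"
    using quad_conj_eq assms by metis
  with assms(7) show "a = c" by simp
  with assms(1,7) show "b = d" by simp
qed

lemma inj_half_sqrt_comb:
  assumes "D \<ge> 2" "squarefree D"
  shows "inj (half_sqrt_comb D)"
proof (rule injI)
  fix w z assume "half_sqrt_comb D w = half_sqrt_comb D z"
  then show "w = z"
    using quad_field_coords_unique[OF assms, of "of_int (fst w)" "of_int (snd w)"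
        "of_int (fst z)" "of_int (snd z)"]
    by (auto simp: half_sqrt_comb_def case_prod_beta intro: prod_eqI)
qed

text \<open>An irrational integer \<open>a + b * sqrt D\<close> is a root of a monic quadratic built
  from its trace \<open>2 * a\<close> and norm \<open>a^2 - D * b^2\<close>, which are thus
  integers. Conversely \<open>4 dvd u^2 - D * v^2\<close> says that the norm of the half-integral
  combination is an integer.\<close>

lemma quad_integers_eq:
  assumes D: "D \<ge> 2" "squarefree D"
  shows "quad_integers D = half_sqrt_comb D ` {(u, v). 4 dvd u\<^sup>2 - D * v\<^sup>2}"
proof (intro equalityI subsetI)
  fix x assume "x \<in> quad_integers D"
  then obtain a b where ab: "a \<in> \<rat>" "b \<in> \<rat>" and x: "x = a + b * sqrt (of_int D)"
    and int: "algebraic_int x"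
    by (auto simp: quad_integers_def quad_field_def)
  show "x \<in> half_sqrt_comb D ` {(u, v). 4 dvd u\<^sup>2 - D * v\<^sup>2}"
  proof (cases "b = 0")
    case True
    with x ab int have "x \<in> \<int>" by (simp add: rational_algebraic_int_is_int)
    then obtain k where "x = of_int k" by (rule Ints_cases)
    then show ?thesis by (intro image_eqI[of _ _ "(2 * k, 0)"]) (auto simp: half_sqrt_comb_def)
  next
    case False
    have irr: "x \<notin> \<rat>"
    proof
      assume "x \<in> \<rat>"
      from quad_field_coords_unique(2)[OF D ab this Rats_0] False x show False by simp
    qed
    have "(a + b * t)\<^sup>2 = (2 * a) * (a + b * t) + (t\<^sup>2 * b\<^sup>2 - a\<^sup>2)" for t
      by algebra
    from this[of "sqrt (of_int D)"] have "x\<^sup>2 = (2 * a) * x + (of_int D * b\<^sup>2 - a\<^sup>2)"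
      using D by (simp add: x)
    moreover have "2 * a \<in> \<rat>" "of_int D * b\<^sup>2 - a\<^sup>2 \<in> \<rat>" using ab by auto
    ultimately have "2 * a \<in> \<int>" "of_int D * b\<^sup>2 - a\<^sup>2 \<in> \<int>"
      using quadratic_algebraic_int_coeffs[OF int irr] by blast+
    then obtain u w where u: "2 * a = of_int u" and w: "of_int D * b\<^sup>2 - a\<^sup>2 = of_int w"
      by (auto elim!: Ints_cases)
    from u have a: "a = of_int u / 2" by simp
    \<comment> \<open>The integral norm and trace make \<open>D * (2 * b)^2\<close> an integer, and
      squarefreeness of \<open>D\<close> passes this on to \<open>2 * b\<close>.\<close>
    have "of_int D * (2 * b)\<^sup>2 = of_int (4 * w + u\<^sup>2)"
      using w by (simp add: a power2_eq_square)
    then have "of_int D * (2 * b)\<^sup>2 \<in> \<int>" by (simp only: Ints_of_int)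
    then have "2 * b \<in> \<int>"
      by (rule rational_mult_square_int[OF D(2), rotated]) (simp add: ab)
    then obtain v where "2 * b = of_int v" by (auto elim!: Ints_cases)
    then have b: "b = of_int v / 2" by simp
    have "(of_int (u\<^sup>2 - D * v\<^sup>2) :: real) = of_int (4 * (- w))"
      using w by (simp add: a b power2_eq_square)
    then have "u\<^sup>2 - D * v\<^sup>2 = 4 * (- w)" by (simp only: of_int_eq_iff)
    then have "4 dvd u\<^sup>2 - D * v\<^sup>2" by simp
    then show ?thesis
      by (intro image_eqI[of _ _ "(u, v)"]) (simp_all add: half_sqrt_comb_def x a b add_divide_distrib)
  qed
next
  fix x assume "x \<in> half_sqrt_comb D ` {(u, v). 4 dvd u\<^sup>2 - D * v\<^sup>2}"
  then obtain u v where x: "x = of_int u / 2 + of_int v / 2 * sqrt (of_int D)"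
    and "4 dvd u\<^sup>2 - D * v\<^sup>2"
    by (auto simp: half_sqrt_comb_def add_divide_distrib)
  then obtain k where k: "u\<^sup>2 - D * v\<^sup>2 = 4 * k" by blast
  have kr: "real_of_int u ^ 2 - of_int D * of_int v ^ 2 = 4 * of_int k"
    using arg_cong[OF k, of real_of_int] by simp
  have "(2 * x - of_int u)\<^sup>2 = of_int D * of_int v ^ 2"
    using D by (simp add: x power_mult_distrib)
  then have "of_int k - of_int u * x + x\<^sup>2 = 0"
    using kr by (simp add: power2_eq_square algebra_simps)
  then have "algebraic_int x"
    \<comment> \<open>The witness is X^2 - uX + k, with trace \<open>u\<close> and norm
      \<open>k\<close>.\<close>
    by (intro algebraic_int.intros[of "[:of_int k, - of_int u, 1:]"])
       (auto simp: coeff_pCons power2_eq_square algebra_simps split: nat.splits)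
  moreover have "x \<in> quad_field D" unfolding quad_field_def x
    by (intro CollectI exI[of _ "of_int u / 2"] exI[of _ "of_int v / 2"]) simp
  ultimately show "x \<in> quad_integers D" by (simp add: quad_integers_def)
qed

text \<open>Total positivity is expressed by positive trace and positive norm, which keeps
  everything in the integers.\<close>

definition positive_coords :: "int \<Rightarrow> (int \<times> int) set" where
  "positive_coords D = {(u, v). 4 dvd u\<^sup>2 - D * v\<^sup>2 \<and> u > 0 \<and> D * v\<^sup>2 < u\<^sup>2}"

lemma totally_positive_integers_eq:
  assumes D: "D \<ge> 2" "squarefree D"
  shows "totally_positive_integers D = half_sqrt_comb D ` positive_coords D"
proof -
  have *: "half_sqrt_comb D (u, v) > 0 \<and> quad_conj D (half_sqrt_comb D (u, v)) > 0 \<longleftrightarrow>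
      u > 0 \<and> D * v\<^sup>2 < u\<^sup>2" for u v
  proof -
    have "quad_conj D (half_sqrt_comb D (u, v)) = of_int u / 2 - of_int v / 2 * sqrt (of_int D)"
      using quad_conj_eq[OF D, of "of_int u / 2" "of_int v / 2"]
      by (simp add: half_sqrt_comb_def add_divide_distrib)
    then have "half_sqrt_comb D (u, v) > 0 \<and> quad_conj D (half_sqrt_comb D (u, v)) > 0 \<longleftrightarrow>
        \<bar>of_int v * sqrt (of_int D)\<bar> < of_int u"
      by (auto simp: half_sqrt_comb_def abs_less_iff)
    \<comment> \<open>Squaring loses the sign of \<open>u\<close>, so \<open>u > 0\<close> is
      recorded separately.\<close>
    also have "\<dots> \<longleftrightarrow> of_int u > (0 :: real) \<and> (of_int v * sqrt (of_int D))\<^sup>2 < (of_int u :: real)\<^sup>2"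
      using abs_le_square_iff[of "of_int u" "of_int v * sqrt (of_int D)"] by linarith
    also have "(of_int v * sqrt (of_int D))\<^sup>2 = (of_int (D * v\<^sup>2) :: real)"
      using D by (simp add: power_mult_distrib)
    also have "(of_int u :: real)\<^sup>2 = of_int (u\<^sup>2)" by simp
    also have "(of_int (D * v\<^sup>2) :: real) < of_int (u\<^sup>2) \<longleftrightarrow> D * v\<^sup>2 < u\<^sup>2" by (rule of_int_less_iff)
    finally show ?thesis by simp
  qed
  show ?thesis
    unfolding totally_positive_integers_def quad_integers_eq[OF D] positive_coords_def
    using * by (auto simp: image_iff)
qed

section \<open>Partitions as multisets of coordinate pairs\<close>

definition coord_partitions :: "int \<Rightarrow> nat \<Rightarrow> (int \<times> int) multiset set" where
  "coord_partitions D n = {N. set_mset N \<subseteq> positive_coords D \<and>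
     (\<Sum>z\<in>#N. fst z) = 2 * int n \<and> (\<Sum>z\<in>#N. snd z) = 0}"

lemma sum_mset_half_sqrt_comb:
  "(\<Sum>z\<in>#N. half_sqrt_comb D z) = half_sqrt_comb D (\<Sum>z\<in>#N. fst z, \<Sum>z\<in>#N. snd z)"
  by (induction N) (auto simp: half_sqrt_comb_def algebra_simps add_divide_distrib)

text \<open>The coordinate map is additive and injective, so a sum equals \<open>n\<close> exactly
  when the coordinate sums are those of \<open>(2 * n, 0)\<close>.\<close>

lemma field_partitions_eq:
  assumes D: "D \<ge> 2" "squarefree D" and n: "n \<ge> 1"
  shows "field_partitions D (of_nat n) = image_mset (half_sqrt_comb D) ` coord_partitions D n"
proof -
  have sum_iff: "(\<Sum>z\<in>#N. half_sqrt_comb D z) = of_nat n \<longleftrightarrow>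
      (\<Sum>z\<in>#N. fst z) = 2 * int n \<and> (\<Sum>z\<in>#N. snd z) = 0" for N
    using inj_eq[OF inj_half_sqrt_comb[OF D], of "(\<Sum>z\<in>#N. fst z, \<Sum>z\<in>#N. snd z)" "(2 * int n, 0)"]
    unfolding sum_mset_half_sqrt_comb by (simp add: half_sqrt_comb_def)
  show ?thesis
  proof (intro equalityI subsetI)
    fix M assume "M \<in> field_partitions D (of_nat n)"
    then have M: "set_mset M \<subseteq> half_sqrt_comb D ` positive_coords D" "sum_mset M = of_nat n"
      by (auto simp: field_partitions_def totally_positive_integers_eq[OF D])
    define N where "N = image_mset (inv_into (positive_coords D) (half_sqrt_comb D)) M"
    have "image_mset (half_sqrt_comb D) N = image_mset id M"
      unfolding N_def multiset.map_comp
      using M(1) by (intro image_mset_cong) (auto simp: f_inv_into_f)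
    then have N: "M = image_mset (half_sqrt_comb D) N" by simp
    moreover have "set_mset N \<subseteq> positive_coords D"
      using M(1) by (simp add: N_def image_subset_iff) (meson inv_into_into subsetD)
    ultimately show "M \<in> image_mset (half_sqrt_comb D) ` coord_partitions D n"
      using M(2) sum_iff[of N] by (auto simp: coord_partitions_def)
  next
    fix M assume "M \<in> image_mset (half_sqrt_comb D) ` coord_partitions D n"
    then obtain N where N: "N \<in> coord_partitions D n" "M = image_mset (half_sqrt_comb D) N" by blast
    \<comment> \<open>The empty multiset has first coordinate sum 0, not
      \<open>2 * n\<close>.\<close>
    then have "N \<noteq> {#}" using n by (auto simp: coord_partitions_def)
    with N show "M \<in> field_partitions D (of_nat n)"
      using sum_iff[of N]
      by (auto simp: field_partitions_def totally_positive_integers_eq[OF D] coord_partitions_def)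
  qed
qed

lemma field_partition_count_eq:
  assumes "D \<ge> 2" "squarefree D" "n \<ge> 1"
  shows "field_partition_count D (of_nat n) = card (coord_partitions D n)"
  unfolding field_partition_count_def field_partitions_eq[OF assms]
  by (rule card_image[OF inj_on_subset[OF multiset.inj_map subset_UNIV]])
     (rule inj_half_sqrt_comb[OF assms(1,2)])

lemma positive_coords_even_iff: "(u, 0) \<in> positive_coords D \<longleftrightarrow> u > 0 \<and> even u"
proof -
  have "4 dvd u\<^sup>2 \<longleftrightarrow> even u" for u :: int
    using pow_divides_pow_iff[of 2 2 u] by simp
  then show ?thesis by (auto simp: positive_coords_def)
qed

text \<open>For any \<open>D\<close>, the map sending \<open>k\<close> to \<open>(2 * k, 0)\<close>
  identifies the classical partitions with those having only rational parts: with second coordinate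
  0, the first one must be even.\<close>

lemma partition_count_eq:
  "partition_count n = card {N \<in> coord_partitions D n. \<forall>z\<in>#N. snd z = 0}"
proof -
  define f where "f = (\<lambda>k. (2 * int k, 0 :: int))"
  have inj: "inj f" by (auto simp: f_def inj_def)
  have sums: "(\<Sum>z\<in>#image_mset f M. fst z) = 2 * int (sum_mset M)"
    "(\<Sum>z\<in>#image_mset f M. snd z) = 0" for M
    by (induction M) (auto simp: f_def)
  have "{N \<in> coord_partitions D n. \<forall>z\<in>#N. snd z = 0} =
      image_mset f ` {M. (\<forall>k\<in>#M. k > 0) \<and> sum_mset M = n}"
  proof (intro equalityI subsetI)
    fix N assume N: "N \<in> {N \<in> coord_partitions D n. \<forall>z\<in>#N. snd z = 0}"
    define M where "M = image_mset (\<lambda>z. nat (fst z div 2)) N"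
    have pos: "fst z > 0 \<and> even (fst z) \<and> snd z = 0" if "z \<in># N" for z
    proof -
      have "(fst z, snd z) \<in> positive_coords D" "snd z = 0"
        using N that unfolding coord_partitions_def prod.collapse by blast+
      then show ?thesis using positive_coords_even_iff[of "fst z" D] by simp
    qed
    have "image_mset f M = image_mset id N"
      unfolding M_def multiset.map_comp
      using pos by (intro image_mset_cong) (force simp: f_def intro: prod_eqI)
    then have fM: "N = image_mset f M" by simp
    then have "2 * int (sum_mset M) = 2 * int n"
      using N sums(1)[of M] unfolding coord_partitions_def by simp
    then have "sum_mset M = n" by (simp del: of_nat_sum_mset)
    moreover have "\<forall>k\<in>#M. k > 0" using pos by (fastforce simp: M_def elim!: evenE)
    ultimately show "N \<in> image_mset f ` {M. (\<forall>k\<in>#M. k > 0) \<and> sum_mset M = n}"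
      using fM by auto
  next
    fix N assume "N \<in> image_mset f ` {M. (\<forall>k\<in>#M. k > 0) \<and> sum_mset M = n}"
    then obtain M where M: "N = image_mset f M" "\<forall>k\<in>#M. k > 0" "sum_mset M = n" by blast
    have "f k \<in> positive_coords D" if "k \<in># M" for k
      using M(2) that by (simp add: f_def positive_coords_even_iff)
    then show "N \<in> {N \<in> coord_partitions D n. \<forall>z\<in>#N. snd z = 0}"
      using sums[of M] M by (auto simp: coord_partitions_def f_def)
  qed
  then show ?thesis
    unfolding partition_count_def
    by (simp add: card_image inj_on_subset[OF multiset.inj_map[OF inj]])
qed

text \<open>First coordinates are positive integers, hence at least 1. This bounds the number of
  parts and shows that leftover parts have nonnegative sum.\<close>

lemma size_le_sum_mset_fst:
  assumes "set_mset N \<subseteq> positive_coords D"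
  shows "int (size N) \<le> (\<Sum>z\<in>#N. fst z)"
  using assms by (induction N) (auto simp: positive_coords_def)

text \<open>Multiset inclusion makes \<open>z\<close> and \<open>w\<close> two separate occurrences,
  possibly of equal value; the remaining parts contribute nonnegatively.\<close>

lemma coord_partitions_fst_le:
  assumes "N \<in> coord_partitions D n" "{#z, w#} \<subseteq># N"
  shows "fst z + fst w \<le> 2 * int n"
proof -
  obtain N' where N': "N = {#z, w#} + N'" using assms(2) by (auto simp: subset_mset.le_iff_add)
  have "set_mset N' \<subseteq> positive_coords D" "fst z + fst w + (\<Sum>z\<in>#N'. fst z) = 2 * int n"
    using assms(1) by (auto simp: N' coord_partitions_def)
  with size_le_sum_mset_fst[of N' D] show ?thesis by linarith
qed

text \<open>Since \<open>card\<close> of an infinite set is 0, the strict inequality of counts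
  relies on finiteness. Parts lie in a fixed box, as \<open>v^2 \<le> D * v^2 < u^2\<close> and
  \<open>u \<le> 2 * n\<close>, and there are at most \<open>2 * n\<close> of them.\<close>

lemma finite_coord_partitions:
  assumes "D \<ge> 1"
  shows "finite (coord_partitions D n)"
proof (rule finite_subset)
  let ?A = "{1..2 * int n} \<times> {- 2 * int n..2 * int n}"
  show "finite (\<Union>k\<le>2 * n. multisets_of_size ?A k)" by auto
  show "coord_partitions D n \<subseteq> (\<Union>k\<le>2 * n. multisets_of_size ?A k)"
  proof
    fix N assume N: "N \<in> coord_partitions D n"
    have "z \<in> ?A" if z: "z \<in># N" for z
    proof -
      obtain u v where uv: "z = (u, v)" by (cases z)
      from z obtain N' where N': "N = add_mset z N'" by (rule mset_add)
      then have "set_mset N' \<subseteq> positive_coords D" "u + (\<Sum>z\<in>#N'. fst z) = 2 * int n"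
        using N by (auto simp: coord_partitions_def uv)
      with size_le_sum_mset_fst[of N' D] have u: "u \<le> 2 * int n" by linarith
      have P: "u > 0" "D * v\<^sup>2 < u\<^sup>2"
        using N z by (auto simp: coord_partitions_def positive_coords_def uv)
      have "1 * v\<^sup>2 \<le> D * v\<^sup>2" using assms by (intro mult_right_mono) auto
      with P have "\<bar>v\<bar> < \<bar>u\<bar>" using abs_le_square_iff[of u v] by linarith
      with P u show ?thesis by (auto simp: uv)
    qed
    moreover have "size N \<le> 2 * n"
      using N size_le_sum_mset_fst[of N D] by (simp add: coord_partitions_def)
    ultimately show "N \<in> (\<Union>k\<le>2 * n. multisets_of_size ?A k)"
      by (auto simp: multisets_of_size_def)
  qed
qed

section \<open>Criteria for equality and for strict inequality of the counts\<close>

lemma partition_count_eqI: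
  assumes "D \<ge> 2" "squarefree D" "n \<ge> 1"
    and no_coords: "\<And>u v. (u, v) \<in> positive_coords D \<Longrightarrow> u \<le> int n \<Longrightarrow> v = 0"
  shows "field_partition_count D (of_nat n) = partition_count n"
proof -
  have "snd z = 0" if N: "N \<in> coord_partitions D n" and z: "z \<in># N" for N z
  proof (rule ccontr)
    assume z0: "snd z \<noteq> 0"
    from z obtain N' where N': "N = add_mset z N'" by (rule mset_add)
    \<comment> \<open>The other second coordinates must cancel \<open>snd z\<close>, so one of them
      is nonzero.\<close>
    have "(\<Sum>z\<in>#N'. snd z) \<noteq> 0" using N z0 by (auto simp: N' coord_partitions_def)
    then have "image_mset snd N' \<noteq> image_mset (\<lambda>_. 0) N'" by (metis sum_mset.neutral_const)
    then have "\<not> (\<forall>w\<in>#N'. snd w = 0)" using image_mset_cong[of N' snd "\<lambda>_. 0"] by blast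
    then obtain w where w: "w \<in># N'" "snd w \<noteq> 0" by blast
    then have "{#z, w#} \<subseteq># N" by (auto simp: N')
    from coord_partitions_fst_le[OF N this] have "fst z \<le> int n \<or> fst w \<le> int n" by linarith
    moreover have "z \<in> positive_coords D" "w \<in> positive_coords D"
      using N w by (auto simp: N' coord_partitions_def)
    ultimately show False
      using no_coords[of "fst z" "snd z"] no_coords[of "fst w" "snd w"] z0 w by auto
  qed
  then have "{N \<in> coord_partitions D n. \<forall>z\<in>#N. snd z = 0} = coord_partitions D n" by blast
  then show ?thesis
    using field_partition_count_eq[OF assms(1-3)] partition_count_eq[of n D] by simp
qed

text \<open>The two given pairs form a partition of \<open>n\<close> outside the rational ones,
  which alone are counted by \<open>partition_count n\<close>.\<close>

lemma partition_count_lessI: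
  assumes "D \<ge> 2" "squarefree D" "n \<ge> 1"
    and uv: "(u, v) \<in> positive_coords D" "(2 * int n - u, - v) \<in> positive_coords D" "v \<noteq> 0"
  shows "field_partition_count D (of_nat n) > partition_count n"
proof -
  let ?N = "{#(u, v), (2 * int n - u, - v)#}"
  have "?N \<in> coord_partitions D n" using uv by (simp add: coord_partitions_def)
  moreover have "\<not> (\<forall>z\<in>#?N. snd z = 0)" using uv(3) by simp
  ultimately have "{N \<in> coord_partitions D n. \<forall>z\<in>#N. snd z = 0} \<subset> coord_partitions D n"
    by blast
  then have "card {N \<in> coord_partitions D n. \<forall>z\<in>#N. snd z = 0} < card (coord_partitions D n)"
    using finite_coord_partitions[of D n] assms(1) by (intro psubset_card_mono) auto
  then show ?thesis
    using field_partition_count_eq[OF assms(1-3)] partition_count_eq[of n D] by simp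
qed

section \<open>Congruences modulo 4 and the upper bounds for D\<close>

lemma square_mod_4: "(x :: int)\<^sup>2 mod 4 = (if even x then 0 else 1)"
proof (cases "even x")
  case True
  then show ?thesis by (auto elim!: evenE simp: power2_eq_square)
next
  case False
  then obtain k where "x = 2 * k + 1" by (rule oddE)
  then have "x\<^sup>2 = 4 * (k\<^sup>2 + k) + 1" by algebra
  then show ?thesis using False by presburger
qed

text \<open>Squares are 0 or 1 modulo 4. An odd \<open>v\<close> would give \<open>u^2\<close> the
  residue of \<open>D\<close>, impossible for 2 and 3; for residue 1 the squares of \<open>u\<close>
  and \<open>v\<close> agree modulo 4.\<close>

lemma four_dvd_norm_cases:
  fixes D u v :: int
  assumes "4 dvd u\<^sup>2 - D * v\<^sup>2"
  shows "D mod 4 = 2 \<or> D mod 4 = 3 \<Longrightarrow> even u \<and> even v"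
    and "D mod 4 = 1 \<Longrightarrow> even u \<longleftrightarrow> even v"
proof -
  have "(u\<^sup>2 mod 4 - (D mod 4) * (v\<^sup>2 mod 4)) mod 4 = (u\<^sup>2 - D * v\<^sup>2) mod 4"
    by (intro mod_diff_cong) (simp_all only: mod_mod_trivial mod_mult_eq)
  then have *: "(u\<^sup>2 mod 4 - (D mod 4) * (v\<^sup>2 mod 4)) mod 4 = 0" using assms by simp
  show "D mod 4 = 2 \<or> D mod 4 = 3 \<Longrightarrow> even u \<and> even v"
    and "D mod 4 = 1 \<Longrightarrow> even u \<longleftrightarrow> even v"
    using * by (auto simp: square_mod_4 split: if_splits)
qed

lemma bound_E_eq: "bound_E n = (int n div 2)\<^sup>2"
  using floor_divide_of_nat_eq[of n 2, where ?'a = real] by (simp add: bound_E_def zdiv_int)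

lemma le_mult_square:
  fixes D v :: int
  assumes "D \<ge> 0" "v \<noteq> 0"
  shows "D \<le> D * v\<^sup>2"
  using assms mult_left_mono[of 1 "v\<^sup>2" D] by (simp add: int_one_le_iff_zero_less)

text \<open>Both coordinates are even, and halving them replaces the bound \<open>n\<close> on
  \<open>u\<close> by \<open>n div 2\<close>.\<close>

lemma positive_coords_bound_E:
  assumes "(u, v) \<in> positive_coords D" "u \<le> int n" "D \<ge> 0" "D mod 4 = 2 \<or> D mod 4 = 3" "v \<noteq> 0"
  shows "D < bound_E n"
proof -
  have P: "4 dvd u\<^sup>2 - D * v\<^sup>2" "u > 0" "D * v\<^sup>2 < u\<^sup>2"
    using assms(1) by (auto simp: positive_coords_def)
  from four_dvd_norm_cases(1)[OF P(1) assms(4)] obtain a b where ab: "u = 2 * a" "v = 2 * b"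
    by (auto elim!: evenE)
  have "D \<le> D * b\<^sup>2" using assms ab by (intro le_mult_square) auto
  also have "\<dots> < a\<^sup>2" using P(3) by (simp add: ab)
  also have "\<dots> \<le> (int n div 2)\<^sup>2" using P(2) assms(2) ab by (intro power_mono) auto
  finally show ?thesis by (simp add: bound_E_eq)
qed

text \<open>For odd \<open>n\<close> the bound \<open>u \<le> n\<close> suffices, and for even
  \<open>n\<close> so does \<open>u \<le> n - 1\<close>. In the remaining case \<open>u = n\<close>
  is even, which makes \<open>v\<close> even, and both coordinates can be halved.\<close>

lemma positive_coords_bound_F:
  assumes "(u, v) \<in> positive_coords D" "u \<le> int n" "D \<ge> 0" "D mod 4 = 1" "v \<noteq> 0"
  shows "D < bound_F n"
proof -
  have P: "4 dvd u\<^sup>2 - D * v\<^sup>2" "u > 0" "D * v\<^sup>2 < u\<^sup>2"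
    using assms(1) by (auto simp: positive_coords_def)
  have D_le: "D \<le> D * v\<^sup>2" using assms by (intro le_mult_square) auto
  show ?thesis
  proof (cases "even n \<and> u = int n")
    case False
    have "D * v\<^sup>2 < u\<^sup>2" by (rule P(3))
    also have "\<dots> \<le> bound_F n"
      using False P(2) assms(2) unfolding bound_F_def by (auto intro!: power_mono)
    finally show ?thesis using D_le by linarith
  next
    case True
    with four_dvd_norm_cases(2)[OF P(1) assms(4)] obtain a b where ab: "u = 2 * a" "v = 2 * b"
      by (auto elim!: evenE)
    have "D \<le> D * b\<^sup>2" using assms ab by (intro le_mult_square) auto
    also have "\<dots> < a\<^sup>2" using P(3) by (simp add: ab)
    \<comment> \<open>Here \<open>n = 2 * a\<close> with \<open>a \<ge> 1\<close>, so
      \<open>a \<le> n - 1\<close>.\<close>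
    also have "\<dots> \<le> (int n - 1)\<^sup>2" using P(2) True ab by (intro power_mono) auto
    finally show ?thesis using True by (simp add: bound_F_def)
  qed
qed

section \<open>Irrational partitions below the bounds\<close>

lemma squarefree_not_square:
  fixes D :: int
  assumes "D \<ge> 2" "squarefree D"
  shows "D \<noteq> k\<^sup>2"
  using sqrt_squarefree_irrational[OF assms] by auto

lemma even_positive_coords:
  assumes "u > 0" "D < u\<^sup>2" "v = 1 \<or> v = - 1"
  shows "(2 * u, 2 * v) \<in> positive_coords D"
  using assms by (auto simp: positive_coords_def power_mult_distrib)

text \<open>The splitting is n = (m + sqrt D) + ((n - m) - sqrt D) with m = floor(n/2). As m is the
  smaller rational part, D < m^2 makes both summands totally positive.\<close>

lemma positive_coords_of_le_E:
  assumes D: "D \<ge> 2" "squarefree D" and le: "D \<le> bound_E n"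
  shows "(2 * (int n div 2), 2) \<in> positive_coords D"
    "(2 * int n - 2 * (int n div 2), - 2) \<in> positive_coords D"
proof -
  define m where "m = int n div 2"
  have m: "m \<ge> 0" "m \<le> int n - m" by (auto simp: m_def)
  \<comment> \<open>The bound is a perfect square and \<open>D\<close> is not, so equality is
    excluded.\<close>
  have less: "D < m\<^sup>2"
    using le squarefree_not_square[OF D, of m] by (simp add: bound_E_eq m_def)
  with D have "m \<noteq> 0" by auto
  with m have "m > 0" by simp
  have "m\<^sup>2 \<le> (int n - m)\<^sup>2" using m by (intro power_mono) auto
  with less have "D < (int n - m)\<^sup>2" by simp
  with less \<open>m > 0\<close> m show "(2 * (int n div 2), 2) \<in> positive_coords D"
    "(2 * int n - 2 * (int n div 2), - 2) \<in> positive_coords D"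
    using even_positive_coords[of m D 1] even_positive_coords[of "int n - m" D "- 1"]
    unfolding m_def[symmetric] by (simp_all add: right_diff_distrib)
qed

lemma odd_positive_coords:
  assumes "D mod 4 = 1" "odd u" "u > 0" "D < u\<^sup>2" "v = 1 \<or> v = - 1"
  shows "(u, v) \<in> positive_coords D"
proof -
  have "u\<^sup>2 mod 4 = D mod 4" using assms by (simp add: square_mod_4)
  then have "4 dvd u\<^sup>2 - D" by (simp add: mod_eq_dvd_iff)
  then show ?thesis using assms by (auto simp: positive_coords_def)
qed

text \<open>The splitting is n = (u + sqrt D)/2 + (2n - u - sqrt D)/2, where \<open>u\<close> is the
  largest odd integer not exceeding \<open>n\<close>; then \<open>2 * n - u\<close> is odd too and
  at least \<open>u\<close>.\<close>

lemma positive_coords_of_le_F: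
  assumes D: "D \<ge> 2" "squarefree D" "D mod 4 = 1" and le: "D \<le> bound_F n"
  obtains u where "(u, 1) \<in> positive_coords D" "(2 * int n - u, - 1) \<in> positive_coords D"
proof -
  define u where "u = (if even n then int n - 1 else int n)"
  have u: "odd u" "u \<le> int n" by (auto simp: u_def)
  have less: "D < u\<^sup>2"
    using le squarefree_not_square[OF D(1,2), of u] by (simp add: bound_F_def u_def split: if_splits)
  \<comment> \<open>For \<open>n = 0\<close> the definition yields \<open>u = - 1\<close>; then
    \<open>D < 1\<close>, against \<open>D \<ge> 2\<close>.\<close>
  have "u > 0"
  proof (rule ccontr)
    assume "\<not> u > 0"
    then have "u = 0 \<or> u = - 1" by (auto simp: u_def split: if_splits)
    with less D show False by auto
  qed
  then have "u\<^sup>2 \<le> (2 * int n - u)\<^sup>2" using u by (intro power_mono) auto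
  with less have "D < (2 * int n - u)\<^sup>2" by simp
  with less u \<open>u > 0\<close> D show thesis
    by (intro that[of u] odd_positive_coords) auto
qed

theorem theorem5p1:
  fixes n :: nat
  assumes "n \<ge> 1"
  shows
    "(\<exists>Dn::real. Dn > 0 \<and>
        (\<forall>D::int. D \<ge> 2 \<and> squarefree D \<and> of_int D > Dn \<longrightarrow>
           field_partition_count D (of_nat n) = partition_count n)) \<and>
     (\<forall>D::int. D \<ge> 2 \<and> squarefree D \<longrightarrow>
        ((D mod 4 = 2 \<or> D mod 4 = 3) \<and> D > bound_E n \<longrightarrow>
           field_partition_count D (of_nat n) = partition_count n) \<and>
        (D mod 4 = 1 \<and> D > bound_F n \<longrightarrow>
           field_partition_count D (of_nat n) = partition_count n) \<and>
        ((D mod 4 = 2 \<or> D mod 4 = 3) \<and> D \<le> bound_E n \<longrightarrow>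
           field_partition_count D (of_nat n) > partition_count n) \<and>
        (D mod 4 = 1 \<and> D \<le> bound_F n \<longrightarrow>
           field_partition_count D (of_nat n) > partition_count n))"
proof -
  have eq_E: "field_partition_count D (of_nat n) = partition_count n"
    if "D \<ge> 2" "squarefree D" "D mod 4 = 2 \<or> D mod 4 = 3" "D > bound_E n" for D
    using partition_count_eqI[OF that(1,2) assms] positive_coords_bound_E[of _ _ D n] that by fastforce
  have eq_F: "field_partition_count D (of_nat n) = partition_count n"
    if "D \<ge> 2" "squarefree D" "D mod 4 = 1" "D > bound_F n" for D
    using partition_count_eqI[OF that(1,2) assms] positive_coords_bound_F[of _ _ D n] that by fastforce
  have less_E: "field_partition_count D (of_nat n) > partition_count n"
    if "D \<ge> 2" "squarefree D" "D \<le> bound_E n" for D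
    using partition_count_lessI[OF that(1,2) assms positive_coords_of_le_E[OF that]] by simp
  have less_F: "field_partition_count D (of_nat n) > partition_count n"
    if D: "D \<ge> 2" "squarefree D" "D mod 4 = 1" "D \<le> bound_F n" for D
  proof -
    from D obtain u where "(u, 1) \<in> positive_coords D" "(2 * int n - u, - 1) \<in> positive_coords D"
      by (rule positive_coords_of_le_F)
    then show ?thesis using partition_count_lessI[OF D(1,2) assms] by simp
  qed
  \<comment> \<open>The uniform threshold exceeds neither less than \<open>bound_E n\<close> nor
    \<open>bound_F n\<close>: it is their maximum, with 1 included to make positivity
    immediate.\<close>
  have eq: "field_partition_count D (of_nat n) = partition_count n"
    if D: "D \<ge> 2" "squarefree D" "of_int D > real_of_int (max 1 (max (bound_E n) (bound_F n)))" for D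
  proof -
    from D(3) have large: "D > bound_E n" "D > bound_F n" by simp_all
    \<comment> \<open>A squarefree \<open>D\<close> is not divisible by the square 4, so the
      residues 1, 2 and 3 exhaust all cases.\<close>
    have "\<not> 4 dvd D" using squarefreeD[OF D(2), of 2] by auto
    then have "D mod 4 = 1 \<or> D mod 4 = 2 \<or> D mod 4 = 3" by presburger
    with eq_E[OF D(1,2)] eq_F[OF D(1,2)] large show ?thesis by blast
  qed
  have "real_of_int (max 1 (max (bound_E n) (bound_F n))) > 0" by simp
  with eq have "\<exists>Dn::real. Dn > 0 \<and>
      (\<forall>D::int. D \<ge> 2 \<and> squarefree D \<and> of_int D > Dn \<longrightarrow>
         field_partition_count D (of_nat n) = partition_count n)" by blast
  then show ?thesis using eq_E eq_F less_E less_F by blast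
qed

end
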